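(* Assume $\mathcal Z$ is a polyhedron, every $g_{i,j}$ is affine, $J$ is convex and piecewise affine, and $V_i=\sum_{j}[g_{i,j}]_+$ for each $i$. Assume also: $\mathcal Z$ is compact, the minima in the lexicographic cascade are attained, the set of minimizers of $J$ on $\mathcal F_L$ is non-empty, and the weighted-sum problem $\min_{z\in\mathcal Z}J(z)+\sum_iw_iV_i(z)$ has a minimizer for every $w\in\mathbb R^L_{++}$; and the lexicographic optimum $z^\star_{\mathrm{lex}}$ is unique, with uniquely determined image $p^\star$. Then: (1) the upper image $\overline{\mathcal P}$ is a full-dimensional polyhedron in $\mathbb R^{L+1}$; (2) $p^\star$ is a vertex of $\overline{\mathcal P}$, and hence $N^+_{\overline{\mathcal P}}(p^\star)$ is full-dimensional; (3) $\Omega(p^\star)$ is a polyhedral region in $\mathbb R^L$; (4) $\Omega(p^\star)$ is non-empty if and only if $\{(w,1):w\in\mathbb R_{++}^L\}\cap N^+_{\overline{\mathcal P}}(p^\star)\neq\varnothing$; (5) $\Omega(p^\star)$ has non-empty interior in $\mathbb R^L$ if and only if the hyperplane $\{(w,1):w\in\mathbb R^L\}$ meets $\operatorname{int}N^+_{\overline{\mathcal P}}(p^\star)$ inside $\mathbb R_{++}^L\times\{1\}$.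
   Context: Let $L\ge1$, $m_1,\dots,m_L\ge1$ and $d\ge 1$ be integers. $\mathcal Z\subset\mathbb R^d$ is the feasible set, $J:\mathbb R^d\to\mathbb R$ is the performance objective, and $g_{i,j}:\mathbb R^d\to\mathbb R$ ($1\le i\le L$, $1\le j\le m_i$) are constraint functions, level $i=1$ having the highest priority. Write $[a]_+=\max(0,a)$ and $\mathbb R_{++}^L=(0,\infty)^L$. The violation functionals are the hinge sums $V_i(z)=\sum_{j=1}^{m_i}[g_{i,j}(z)]_+$. Lexicographic cascade: $\mathcal F_0=\mathcal Z$, and for $i=1,\dots,L$, $V_i^\star=\min_{z\in\mathcal F_{i-1}}V_i(z)$, $\mathcal F_i=\{z\in\mathcal F_{i-1}:V_i(z)=V_i^\star\}$. The lexicographic optimum is $z^\star_{\mathrm{lex}}\in\arg\min_{z\in\mathcal F_L}J(z)$, with $J^\star=J(z^\star_{\mathrm{lex}})$ and image $p^\star=(V_1^\star,\dots,V_L^\star,J^\star)\in\mathbb R^{L+1}$. Upper image: $\overline{\mathcal P}=\mathrm{cl}\{(y,t)\in\mathbb R^{L}\times\mathbb R:\exists z\in\mathcal Z,\ V_i(z)\le y_i\ \forall i,\ J(z)\le t\}$. Outward normal cone (in the paper's sign convention): $N^+_{\overline{\mathcal P}}(p^\star)=\{\eta\in\mathbb R^{L+1}:\langle\eta,q-p^\star\rangle\ge0\ \forall q\in\overline{\mathcal P}\}$. Normalized equivalence region: $\Omega(p^\star)=\{w\in\mathbb R_{++}^L:(w,1)\in N^+_{\overline{\mathcal P}}(p^\star)\}$.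 A "polyhedral region" here means a set of the form $\{w\in\mathbb R_{++}^L:Cw\le d_0,\ Ew=f\}$ for some matrices $C,E$ and vectors $d_0,f$ (i.e. the intersection of a polyhedron with the open positive orthant). *)

theory Defs
  imports "HOL-Analysis.Analysis"
begin

definition affine_fun :: "('a::euclidean_space \<Rightarrow> real) \<Rightarrow> bool" where
  "affine_fun f \<longleftrightarrow> (\<exists>a b. \<forall>x. f x = a \<bullet> x + b)"

definition piecewise_affine :: "('a::euclidean_space \<Rightarrow> real) \<Rightarrow> bool" where
  "piecewise_affine f \<longleftrightarrow>
     (\<exists>\<P>. finite \<P> \<and> (\<forall>P\<in>\<P>. polyhedron P) \<and> \<Union>\<P> = UNIV \<and>
        (\<forall>P\<in>\<P>. \<exists>h. affine_fun h \<and> (\<forall>x\<in>P. f x = h x)))"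

definition hinge_sum :: "nat \<Rightarrow> (nat \<Rightarrow> 'a \<Rightarrow> real) \<Rightarrow> 'a \<Rightarrow> real" where
  "hinge_sum n g z = (\<Sum>j=1..n. max 0 (g j z))"

text \<open>The lexicographic cascade, with levels numbered from 1. The infimum is the minimum
  whenever the latter is attained, which the theorem assumes at every level.\<close>

primrec lex_feasible :: "'a set \<Rightarrow> (nat \<Rightarrow> 'a \<Rightarrow> real) \<Rightarrow> nat \<Rightarrow> 'a set" where
  "lex_feasible Z V 0 = Z"
| "lex_feasible Z V (Suc i) =
     {z \<in> lex_feasible Z V i. V (Suc i) z = (INF x\<in>lex_feasible Z V i. V (Suc i) x)}"

definition lex_value :: "'a set \<Rightarrow> (nat \<Rightarrow> 'a \<Rightarrow> real) \<Rightarrow> nat \<Rightarrow> real" where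
  "lex_value Z V i = (INF z\<in>lex_feasible Z V (i - 1). V i z)"

text \<open>Vectors in \<open>\<real>\<^sup>L\<close> are elements of \<open>real ^ 'l\<close>, where \<open>lev :: 'l \<Rightarrow> nat\<close> is a bijection
  onto \<open>{1..L}\<close>: the coordinate with index \<open>l\<close> belongs to level \<open>lev l\<close>.\<close>

definition weighted_sum ::
  "('l::finite \<Rightarrow> nat) \<Rightarrow> (nat \<Rightarrow> 'a \<Rightarrow> real) \<Rightarrow> ('a \<Rightarrow> real) \<Rightarrow> real ^ 'l \<Rightarrow> 'a \<Rightarrow> real" where
  "weighted_sum lev V J w z = J z + (\<Sum>l\<in>UNIV. w $ l * V (lev l) z)"

definition upper_image ::
  "('l::finite \<Rightarrow> nat) \<Rightarrow> 'a set \<Rightarrow> (nat \<Rightarrow> 'a \<Rightarrow> real) \<Rightarrow> ('a \<Rightarrow> real) \<Rightarrow> ((real ^ 'l) \<times> real) set"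
  where
  "upper_image lev Z V J =
     closure {(y, t). \<exists>z\<in>Z. (\<forall>l. V (lev l) z \<le> y $ l) \<and> J z \<le> t}"

definition outward_normal_cone :: "'a::euclidean_space set \<Rightarrow> 'a \<Rightarrow> 'a set" where
  "outward_normal_cone P p = {\<eta>. \<forall>q\<in>P. \<eta> \<bullet> (q - p) \<ge> 0}"

definition pos_orthant :: "(real ^ 'l::finite) set" where
  "pos_orthant = {w. \<forall>l. w $ l > 0}"

definition equivalence_region ::
  "((real ^ 'l::finite) \<times> real) set \<Rightarrow> (real ^ 'l) \<times> real \<Rightarrow> (real ^ 'l) set" where
  "equivalence_region P p = {w \<in> pos_orthant. (w, 1) \<in> outward_normal_cone P p}"

text \<open>\<open>C k\<close> and \<open>E k\<close> are the rows of the matrices in \<open>C w \<le> d\<close> and \<open>E w = f\<close>.\<close>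

definition polyhedral_region :: "(real ^ 'l::finite) set \<Rightarrow> bool" where
  "polyhedral_region S \<longleftrightarrow>
     (\<exists>(r::nat) (s::nat) (C::nat \<Rightarrow> real ^ 'l) d (E::nat \<Rightarrow> real ^ 'l) f.
        S = {w \<in> pos_orthant. (\<forall>k<r. C k \<bullet> w \<le> d k) \<and> (\<forall>k<s. E k \<bullet> w = f k)})"

end

theory Submission
  imports Defs
begin

text \<open>
  On a common polyhedral refinement of the linearity domains of \<open>J\<close> and of all hinge terms, the
  outcome map \<open>z \<mapsto> (V z, J z)\<close> is affine, so it sends each of the finitely many polytopes into
  which \<open>Z\<close> is cut to the convex hull of the images of its vertices. Together with
  the convexity of the outcome map this shows that the set of outcomes that are dominated by
  a feasible one is \<open>convex hull S + K\<close>, where \<open>S\<close> is a finite set of outcomes and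
  \<open>K\<close> is the nonnegative orthant (\<open>dominated_set_eq_hull_plus_orthant\<close>). Such a sum is the
  slice at height 1 of a finitely generated cone one dimension higher, hence a polyhedron
  (\<open>polyhedron_convex_hull_plus_cone\<close>). In particular it is closed, so that it is the upper image,
  and it is full-dimensional because it contains a translate of \<open>K\<close>.

  The lexicographic outcome is a vertex: if it lies strictly between two points of the upper
  image, then feasible points below these two must attain the optimal value of level 1, since neither
  can beat it and their average may not exceed it; so they are both feasible for level 2, and the same
  argument applies to every further level and in the end to \<open>J\<close> (\<open>lex_outcome_extreme\<close>). At a vertex
  of a polyhedron the active constraint normals span the space, because a direction orthogonal to
  all of them could be followed both ways without leaving the polyhedron. They are normal
  vectors up to sign, so the normal cone is full-dimensional
  (\<open>aff_dim_outward_normal_cone_extreme_point\<close>).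

  For \<open>w > 0\<close> the functional \<open>(w, 1)\<close> is nonnegative on \<open>K\<close>. Whether it belongs to
  the normal cone is therefore decided by the finitely many points of \<open>S\<close>, which gives the linear
  inequalities for the equivalence region. Finally, a ball inside the equivalence region, placed at
  height 1 and scaled by all positive factors, is an open subset of the normal cone
  (\<open>interior_slice_cone_iff\<close>).
\<close>

section \<open>Piecewise affine functions\<close>

lemma affine_fun_add: "affine_fun f \<Longrightarrow> affine_fun g \<Longrightarrow> affine_fun (\<lambda>x. f x + g x)"
  unfolding affine_fun_def
proof (elim exE)
  fix a b c d assume "\<forall>x. f x = a \<bullet> x + b" "\<forall>x. g x = c \<bullet> x + d"
  then have "\<forall>x. f x + g x = (a + c) \<bullet> x + (b + d)" by (simp add: inner_add_left)
  then show "\<exists>a b. \<forall>x. f x + g x = a \<bullet> x + b" by blast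
qed

lemma affine_fun_const: "affine_fun (\<lambda>x. c)"
  unfolding affine_fun_def by (rule exI[of _ 0]) simp

lemma affine_fun_sum:
  assumes "finite I" "\<And>i. i \<in> I \<Longrightarrow> affine_fun (f i)"
  shows "affine_fun (\<lambda>x. \<Sum>i\<in>I. f i x)"
  using assms by (induction I rule: finite_induct) (auto intro: affine_fun_add affine_fun_const)

lemma common_affine_refinement:
  fixes f :: "'i \<Rightarrow> 'a::euclidean_space \<Rightarrow> real"
  assumes "finite I" "\<And>i. i \<in> I \<Longrightarrow> piecewise_affine (f i)"
  obtains \<P> where "finite \<P>" "\<forall>p\<in>\<P>. polyhedron p" "\<Union>\<P> = UNIV"
    "\<forall>p\<in>\<P>. \<forall>i\<in>I. \<exists>h. affine_fun h \<and> (\<forall>x\<in>p. f i x = h x)"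
proof -
  have "\<exists>\<P>. finite \<P> \<and> (\<forall>p\<in>\<P>. polyhedron p) \<and> \<Union>\<P> = UNIV \<and>
          (\<forall>p\<in>\<P>. \<forall>i\<in>I. \<exists>h. affine_fun h \<and> (\<forall>x\<in>p. f i x = h x))"
    using assms
  proof (induction I rule: finite_induct)
    case empty
    show ?case by (rule exI[of _ "{UNIV}"]) simp
  next
    case (insert j I)
    then obtain \<P> where P: "finite \<P>" "\<forall>p\<in>\<P>. polyhedron p" "\<Union>\<P> = UNIV"
      "\<forall>p\<in>\<P>. \<forall>i\<in>I. \<exists>h. affine_fun h \<and> (\<forall>x\<in>p. f i x = h x)" by auto
    obtain \<Q> where Q: "finite \<Q>" "\<forall>q\<in>\<Q>. polyhedron q" "\<Union>\<Q> = UNIV"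
      "\<forall>q\<in>\<Q>. \<exists>h. affine_fun h \<and> (\<forall>x\<in>q. f j x = h x)"
      using insert.prems[of j] unfolding piecewise_affine_def by auto
    define \<R> where "\<R> = (\<lambda>(p, q). p \<inter> q) ` (\<P> \<times> \<Q>)"
    have "finite \<R>" "\<forall>r\<in>\<R>. polyhedron r"
      using P Q by (auto simp: \<R>_def)
    moreover have "\<Union>\<R> = UNIV"
    proof (intro equalityI subsetI UNIV_I)
      fix x :: 'a
      obtain p q where "p \<in> \<P>" "q \<in> \<Q>" "x \<in> p" "x \<in> q" using P(3) Q(3) by blast
      then show "x \<in> \<Union>\<R>" unfolding \<R>_def by force
    qed
    moreover have "\<exists>h. affine_fun h \<and> (\<forall>x\<in>r. f i x = h x)" if "r \<in> \<R>" "i \<in> insert j I" for r i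
    proof -
      obtain p q where r: "r = p \<inter> q" "p \<in> \<P>" "q \<in> \<Q>" using \<open>r \<in> \<R>\<close> by (auto simp: \<R>_def)
      show ?thesis
      proof (cases "i = j")
        case True
        then show ?thesis using Q(4) r by (meson IntD2)
      next
        case False
        then show ?thesis using P(4) r that(2) by (meson IntD1 insertE)
      qed
    qed
    ultimately show ?case by (intro exI[of _ \<R>]) simp
  qed
  then obtain \<P> where "finite \<P>" "\<forall>p\<in>\<P>. polyhedron p" "\<Union>\<P> = UNIV"
    "\<forall>p\<in>\<P>. \<forall>i\<in>I. \<exists>h. affine_fun h \<and> (\<forall>x\<in>p. f i x = h x)" by (elim exE conjE)
  then show thesis by (rule that)
qed

lemma piecewise_affine_sum:
  assumes "finite I" "\<And>i. i \<in> I \<Longrightarrow> piecewise_affine (f i)"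
  shows "piecewise_affine (\<lambda>x. \<Sum>i\<in>I. f i x)"
proof -
  obtain \<P> where P: "finite \<P>" "\<forall>p\<in>\<P>. polyhedron p" "\<Union>\<P> = UNIV"
    "\<forall>p\<in>\<P>. \<forall>i\<in>I. \<exists>h. affine_fun h \<and> (\<forall>x\<in>p. f i x = h x)"
    by (rule common_affine_refinement[OF assms])
  have "\<exists>h. affine_fun h \<and> (\<forall>x\<in>p. (\<Sum>i\<in>I. f i x) = h x)" if p: "p \<in> \<P>" for p
  proof -
    obtain h where h: "\<forall>i\<in>I. affine_fun (h i) \<and> (\<forall>x\<in>p. f i x = h i x)"
      using bspec[OF P(4) p] by metis
    then have "affine_fun (\<lambda>x. \<Sum>i\<in>I. h i x)" by (auto intro: affine_fun_sum[OF assms(1)])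
    moreover have "\<forall>x\<in>p. (\<Sum>i\<in>I. f i x) = (\<Sum>i\<in>I. h i x)" using h by (auto intro: sum.cong)
    ultimately show ?thesis by blast
  qed
  then show ?thesis unfolding piecewise_affine_def using P(1-3) by (intro exI[of _ \<P>]) simp
qed

lemma piecewise_affine_hinge:
  assumes "affine_fun f"
  shows "piecewise_affine (\<lambda>x. max 0 (f x))"
proof -
  obtain a b where ab: "\<And>x. f x = a \<bullet> x + b" using assms unfolding affine_fun_def by blast
  let ?p = "{x. a \<bullet> x \<ge> -b}" and ?q = "{x. a \<bullet> x \<le> -b}"
  have "\<exists>h. affine_fun h \<and> (\<forall>x\<in>?p. max 0 (f x) = h x)"
    by (rule exI[of _ f]) (use assms ab in auto)
  moreover have "\<exists>h. affine_fun h \<and> (\<forall>x\<in>?q. max 0 (f x) = h x)"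
    by (rule exI[of _ "\<lambda>x. 0"]) (use ab affine_fun_const in auto)
  moreover have "\<Union>{?p, ?q} = UNIV" by auto
  moreover have "\<forall>r\<in>{?p, ?q}. polyhedron r"
    by (simp add: polyhedron_halfspace_ge polyhedron_halfspace_le)
  ultimately show ?thesis
    unfolding piecewise_affine_def by (intro exI[of _ "{?p, ?q}"]) simp
qed

lemma piecewise_affine_hinge_sum:
  assumes "\<And>j. j \<in> {1..n} \<Longrightarrow> affine_fun (g j)"
  shows "piecewise_affine (hinge_sum n g)"
proof -
  have "hinge_sum n g = (\<lambda>z. \<Sum>j=1..n. max 0 (g j z))" by (simp add: hinge_sum_def fun_eq_iff)
  then show ?thesis using assms by (auto intro!: piecewise_affine_sum piecewise_affine_hinge)
qed

lemma convex_on_hinge_sum: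
  fixes g :: "nat \<Rightarrow> 'a::euclidean_space \<Rightarrow> real"
  assumes "\<And>j. j \<in> {1..n} \<Longrightarrow> affine_fun (g j)"
  shows "convex_on UNIV (hinge_sum n g)"
proof (rule convex_onI)
  fix t :: real and x y :: 'a
  assume t: "0 < t" "t < 1"
  have *: "max 0 (g j ((1 - t) *\<^sub>R x + t *\<^sub>R y)) \<le> (1 - t) * max 0 (g j x) + t * max 0 (g j y)"
    if j: "j \<in> {1..n}" for j
  proof -
    obtain a b where ab: "\<And>x. g j x = a \<bullet> x + b" using assms[OF j] unfolding affine_fun_def by blast
    have "g j ((1 - t) *\<^sub>R x + t *\<^sub>R y) = (1 - t) * g j x + t * g j y"
      by (simp add: ab inner_add_right algebra_simps)
    also have "\<dots> \<le> (1 - t) * max 0 (g j x) + t * max 0 (g j y)"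
      using t by (intro add_mono mult_left_mono) auto
    finally show ?thesis using t by simp
  qed
  show "hinge_sum n g ((1 - t) *\<^sub>R x + t *\<^sub>R y) \<le> (1 - t) * hinge_sum n g x + t * hinge_sum n g y"
    unfolding hinge_sum_def sum_distrib_left sum.distrib[symmetric] by (intro sum_mono *)
qed simp

section \<open>Polyhedra generated by points and directions\<close>

lemma polyhedron_slice:
  fixes C :: "('a::euclidean_space \<times> real) set"
  assumes "polyhedron C"
  shows "polyhedron {x. (x, 1) \<in> C}"
proof -
  obtain F where F: "finite F" "C = \<Inter>F" "\<forall>h\<in>F. \<exists>a b. a \<noteq> 0 \<and> h = {x. a \<bullet> x \<le> b}"
    using assms unfolding polyhedron_def by blast
  have "{x. (x, 1) \<in> C} = \<Inter>((\<lambda>h. {x. (x, 1) \<in> h}) ` F)" using F(2) by auto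
  moreover have "polyhedron {x. (x, 1) \<in> h}" if hF: "h \<in> F" for h
  proof -
    obtain a b where h: "h = {x. a \<bullet> x \<le> b}" using F(3) hF by blast
    have "{x. (x, 1) \<in> h} = {x. fst a \<bullet> x \<le> b - snd a}"
      by (auto simp: h inner_prod_def)
    then show ?thesis by (simp add: polyhedron_halfspace_le)
  qed
  ultimately show ?thesis using F(1) by auto
qed

text \<open>Homogenization: points are lifted to height 1 and directions to height 0, and the set is the
  slice at height 1 of the cone that they generate.\<close>

lemma polyhedron_convex_hull_plus_cone:
  fixes S E :: "'a::euclidean_space set"
  assumes "finite S" "finite E"
  shows "polyhedron {s + k | s k. s \<in> convex hull S \<and> k \<in> convex_cone hull E}"
proof -
  let ?C = "convex_cone hull (S \<times> {1::real} \<union> (\<lambda>x. (x, 0)) ` E)"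
  have hS: "convex hull (S \<times> {1::real}) = (convex hull S) \<times> {1}"
    by (simp add: convex_hull_Times)
  have lin: "linear (\<lambda>x::'a. (x, 0::real))"
    by (rule linearI) auto
  have hE: "convex_cone hull ((\<lambda>x. (x, 0::real)) ` E) = (\<lambda>x. (x, 0)) ` (convex_cone hull E)"
    using convex_cone_hull_linear_image[OF lin] .
  have "(x, 1) \<in> ?C \<longleftrightarrow> (\<exists>s k. x = s + k \<and> s \<in> convex hull S \<and> k \<in> convex_cone hull E)" for x
  proof
    assume "(x, 1) \<in> ?C"
    then obtain u k where uk: "u \<in> convex_cone hull (S \<times> {1::real})" "k \<in> convex_cone hull E"
      "(x, 1) = u + (k, 0)"
      unfolding convex_cone_hull_Un hE by blast
    then have "u \<noteq> 0" by auto
    then obtain s c where "s \<in> convex hull S" "u = c *\<^sub>R (s, 1)"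
      using uk(1) unfolding convex_cone_hull_convex_hull hS by auto
    then have "x = s + k" using uk(3) by simp
    then show "\<exists>s k. x = s + k \<and> s \<in> convex hull S \<and> k \<in> convex_cone hull E"
      using \<open>s \<in> _\<close> uk(2) by blast
  next
    assume "\<exists>s k. x = s + k \<and> s \<in> convex hull S \<and> k \<in> convex_cone hull E"
    then obtain s k where x: "x = s + k" "s \<in> convex hull S" "k \<in> convex_cone hull E" by blast
    have "(s, 1) \<in> convex_cone hull (S \<times> {1::real})"
      using x(2) hS convex_hull_subset_convex_cone_hull[of "S \<times> {1::real}"] by auto
    moreover have "(k, 0::real) \<in> convex_cone hull ((\<lambda>x. (x, 0)) ` E)" using x(3) hE by auto
    moreover have "(x, 1::real) = (s, 1) + (k, 0)" using x(1) by simp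
    ultimately show "(x, 1) \<in> ?C" unfolding convex_cone_hull_Un by blast
  qed
  then have "{s + k | s k. s \<in> convex hull S \<and> k \<in> convex_cone hull E} = {x. (x, 1) \<in> ?C}"
    by auto
  moreover have "polyhedron ?C" using assms by (intro polyhedron_convex_cone_hull) auto
  ultimately show ?thesis using polyhedron_slice by metis
qed

lemma convex_cone_hull_Basis:
  "convex_cone hull Basis = {x::'a::euclidean_space. \<forall>b\<in>Basis. 0 \<le> x \<bullet> b}"
proof
  have "convex_cone {x::'a. \<forall>b\<in>Basis. 0 \<le> x \<bullet> b}"
    unfolding convex_cone_iff by (auto simp: inner_add_left)
  moreover have "Basis \<subseteq> {x::'a. \<forall>b\<in>Basis. 0 \<le> x \<bullet> b}" by (auto simp: inner_Basis)
  ultimately show "convex_cone hull Basis \<subseteq> {x::'a. \<forall>b\<in>Basis. 0 \<le> x \<bullet> b}"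
    by (rule hull_minimal[rotated])
  show "{x::'a. \<forall>b\<in>Basis. 0 \<le> x \<bullet> b} \<subseteq> convex_cone hull Basis"
  proof clarify
    fix x :: 'a assume x: "\<forall>b\<in>Basis. 0 \<le> x \<bullet> b"
    have "(\<Sum>b\<in>B. (x \<bullet> b) *\<^sub>R b) \<in> convex_cone hull Basis" if "B \<subseteq> Basis" for B :: "'a set"
      using finite_subset[OF that finite_Basis] that
    proof (induction B rule: finite_induct)
      case empty
      show ?case by (simp add: convex_cone_hull_contains_0)
    next
      case (insert b B)
      then show ?case using x by (simp add: convex_cone_hull_add convex_cone_hull_mul hull_inc)
    qed
    from this[of Basis] show "x \<in> convex_cone hull Basis" by (simp add: euclidean_representation)
  qed
qed

section \<open>Outcomes dominated by a feasible outcome\<close>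

text \<open>The components of a point of a Euclidean space are its inner products with the standard basis;
  this treats the pair of violations and objective as a single vector.\<close>

definition dominated_set :: "('a \<Rightarrow> 'b::euclidean_space) \<Rightarrow> 'a set \<Rightarrow> 'b set" where
  "dominated_set F Z = {q. \<exists>z\<in>Z. \<forall>b\<in>Basis. F z \<bullet> b \<le> q \<bullet> b}"

lemma convex_dominated_set:
  assumes "convex Z" "\<And>b. b \<in> Basis \<Longrightarrow> convex_on Z (\<lambda>z. F z \<bullet> b)"
  shows "convex (dominated_set F Z)"
proof (rule convexI)
  fix x y and u v :: real
  assume "x \<in> dominated_set F Z" "y \<in> dominated_set F Z" and uv: "0 \<le> u" "0 \<le> v" "u + v = 1"
  then obtain z1 z2 where z: "z1 \<in> Z" "z2 \<in> Z"
    "\<forall>b\<in>Basis. F z1 \<bullet> b \<le> x \<bullet> b" "\<forall>b\<in>Basis. F z2 \<bullet> b \<le> y \<bullet> b"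
    unfolding dominated_set_def by blast
  have "F (u *\<^sub>R z1 + v *\<^sub>R z2) \<bullet> b \<le> (u *\<^sub>R x + v *\<^sub>R y) \<bullet> b" if b: "b \<in> Basis" for b
  proof -
    have "F (u *\<^sub>R z1 + v *\<^sub>R z2) \<bullet> b \<le> u * (F z1 \<bullet> b) + v * (F z2 \<bullet> b)"
      using assms(2)[OF b] z(1,2) uv unfolding convex_on_def by blast
    also have "\<dots> \<le> u * (x \<bullet> b) + v * (y \<bullet> b)"
      using z(3,4) uv b by (intro add_mono mult_left_mono) auto
    finally show ?thesis by (simp add: inner_add_left)
  qed
  moreover have "u *\<^sub>R z1 + v *\<^sub>R z2 \<in> Z" using assms(1) z(1,2) uv by (simp add: convexD)
  ultimately show "u *\<^sub>R x + v *\<^sub>R y \<in> dominated_set F Z" unfolding dominated_set_def by blast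
qed

text \<open>The set \<open>S\<close> collects the images of the vertices of all polytopes on which \<open>F\<close> is affine.
  Affinity puts every outcome into \<open>convex hull S\<close>; convexity of the components of \<open>F\<close> is what
  keeps \<open>convex hull S\<close> inside the dominated set when the polytopes are mixed.\<close>

lemma dominated_set_eq_hull_plus_orthant:
  fixes F :: "'a::euclidean_space \<Rightarrow> 'b::euclidean_space"
  assumes poly: "polytope Z"
    and conv: "\<And>b. b \<in> Basis \<Longrightarrow> convex_on Z (\<lambda>z. F z \<bullet> b)"
    and pw: "\<And>b. b \<in> Basis \<Longrightarrow> piecewise_affine (\<lambda>z. F z \<bullet> b)"
  obtains S where "finite S" "S \<subseteq> F ` Z"
    "dominated_set F Z = {s + k | s k. s \<in> convex hull S \<and> k \<in> convex_cone hull Basis}"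
proof -
  obtain \<P> where P: "finite \<P>" "\<forall>p\<in>\<P>. polyhedron p" "\<Union>\<P> = UNIV"
    "\<forall>p\<in>\<P>. \<forall>b\<in>Basis. \<exists>h. affine_fun h \<and> (\<forall>x\<in>p. F x \<bullet> b = h x)"
    by (rule common_affine_refinement[OF finite_Basis pw])
  have "\<exists>T. finite T \<and> Z \<inter> p = convex hull T" if "p \<in> \<P>" for p
    using polytope_Int_polyhedron[OF poly bspec[OF P(2) that]] unfolding polytope_def .
  then obtain T where T: "\<And>p. p \<in> \<P> \<Longrightarrow> finite (T p) \<and> Z \<inter> p = convex hull (T p)" by metis
  have TZ: "T p \<subseteq> Z \<inter> p" if "p \<in> \<P>" for p
    using T[OF that] hull_subset[of "T p" convex] by simp
  define S where "S = F ` (\<Union>p\<in>\<P>. T p)"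
  have fin: "finite S" unfolding S_def using T P(1) by auto
  have sub: "S \<subseteq> F ` Z" unfolding S_def using TZ by blast
  have inS: "F z \<in> convex hull S" if "z \<in> Z" for z
  proof -
    obtain p where p: "p \<in> \<P>" "z \<in> p" using P(3) by blast
    then have "z \<in> convex hull (T p)" using T that by blast
    then obtain u where u: "\<forall>x\<in>T p. 0 \<le> u x" "sum u (T p) = 1" "(\<Sum>x\<in>T p. u x *\<^sub>R x) = z"
      using T[OF p(1)] by (auto simp: convex_hull_finite)
    have "F z = (\<Sum>x\<in>T p. u x *\<^sub>R F x)"
    proof (rule euclidean_eqI)
      fix b :: 'b assume b: "b \<in> Basis"
      obtain a c where ac: "\<And>x. x \<in> p \<Longrightarrow> F x \<bullet> b = a \<bullet> x + c"
        using bspec[OF bspec[OF P(4) p(1)] b] unfolding affine_fun_def by auto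
      have "F z \<bullet> b = a \<bullet> (\<Sum>x\<in>T p. u x *\<^sub>R x) + c * sum u (T p)"
        using ac[OF p(2)] u by simp
      also have "\<dots> = (\<Sum>x\<in>T p. u x * (a \<bullet> x + c))"
        by (simp add: inner_sum_right sum_distrib_left sum.distrib algebra_simps)
      also have "\<dots> = (\<Sum>x\<in>T p. u x * (F x \<bullet> b))"
        by (intro sum.cong refl) (use ac TZ[OF p(1)] in auto)
      finally show "F z \<bullet> b = (\<Sum>x\<in>T p. u x *\<^sub>R F x) \<bullet> b" by (simp add: inner_sum_left)
    qed
    moreover have "(\<Sum>x\<in>T p. u x *\<^sub>R F x) \<in> convex hull S"
      by (rule convex_sum)
         (use T[OF p(1)] u p(1) in \<open>auto simp: S_def intro!: hull_inc convex_convex_hull\<close>)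
    ultimately show ?thesis by simp
  qed
  have "dominated_set F Z = {s + k | s k. s \<in> convex hull S \<and> k \<in> convex_cone hull Basis}"
    (is "_ = ?R")
  proof (intro equalityI subsetI)
    fix q assume "q \<in> dominated_set F Z"
    then obtain z where z: "z \<in> Z" "\<forall>b\<in>Basis. F z \<bullet> b \<le> q \<bullet> b" unfolding dominated_set_def by blast
    have "q = F z + (q - F z)" by simp
    moreover have "q - F z \<in> convex_cone hull Basis"
      using z(2) by (simp add: convex_cone_hull_Basis inner_diff_left)
    ultimately show "q \<in> ?R" using inS[OF z(1)] by blast
  next
    fix q assume "q \<in> ?R"
    then obtain s k where q: "q = s + k" "s \<in> convex hull S" "\<forall>b\<in>Basis. 0 \<le> k \<bullet> b"
      by (auto simp: convex_cone_hull_Basis)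
    have "S \<subseteq> dominated_set F Z" using sub by (auto simp: dominated_set_def)
    moreover have "convex (dominated_set F Z)"
      by (intro convex_dominated_set conv polytope_imp_convex poly)
    ultimately have "s \<in> dominated_set F Z" using q(2) hull_minimal by blast
    then obtain z where z: "z \<in> Z" "\<forall>b\<in>Basis. F z \<bullet> b \<le> s \<bullet> b" unfolding dominated_set_def by blast
    then have "\<forall>b\<in>Basis. F z \<bullet> b \<le> q \<bullet> b" using q(1,3) by (auto simp: inner_add_left add_increasing2)
    then show "q \<in> dominated_set F Z" using z(1) unfolding dominated_set_def by blast
  qed
  then show thesis using that fin sub by blast
qed

lemma aff_dim_dominated_set:
  fixes F :: "'a \<Rightarrow> 'b::euclidean_space"
  assumes "z \<in> Z"
  shows "aff_dim (dominated_set F Z) = int DIM('b)"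
proof -
  have "box (F z) (F z + One) \<subseteq> dominated_set F Z"
    using assms by (force simp: dominated_set_def mem_box)
  moreover have "aff_dim (box (F z) (F z + One)) = int DIM('b)"
    by (rule aff_dim_open) (auto simp: box_ne_empty inner_add_left)
  ultimately show ?thesis by (metis aff_dim_le_DIM aff_dim_subset order_antisym)
qed

section \<open>Normal cones\<close>

text \<open>If the normal cone at \<open>p\<close> spanned a proper subspace, some \<open>v \<noteq> 0\<close> would be orthogonal to
  every constraint normal that is active at \<open>p\<close>. Then \<open>p + s v\<close> stays in \<open>P\<close> for all small \<open>s\<close> of
  either sign, because inactive constraints have slack, and \<open>p\<close> would be a midpoint.\<close>

lemma aff_dim_outward_normal_cone_extreme_point:
  fixes P :: "'a::euclidean_space set"
  assumes "polyhedron P" "p extreme_point_of P"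
  shows "aff_dim (outward_normal_cone P p) = int DIM('a)"
proof -
  let ?N = "outward_normal_cone P p"
  obtain F where F: "finite F" "P = \<Inter>F" "\<forall>h\<in>F. \<exists>a b. a \<noteq> 0 \<and> h = {x. a \<bullet> x \<le> b}"
    using assms(1) unfolding polyhedron_def by blast
  have p: "p \<in> P" using assms(2) by (simp add: extreme_point_of_def)
  have "\<not> dim ?N < DIM('a)"
  proof
    assume "dim ?N < DIM('a)"
    then obtain v where v: "v \<noteq> 0" "\<And>y. y \<in> span ?N \<Longrightarrow> orthogonal v y"
      using orthogonal_to_subspace_exists by blast
    have "\<forall>\<^sub>F s in at 0. p + s *\<^sub>R v \<in> h" if h: "h \<in> F" for h
    proof -
      obtain a b where ab: "h = {x. a \<bullet> x \<le> b}" using F(3) h by blast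
      have Ph: "a \<bullet> q \<le> b" if "q \<in> P" for q using that h F(2) ab by blast
      show ?thesis
      proof (cases "a \<bullet> p = b")
        case True
        then have "- a \<in> ?N" using Ph by (auto simp: outward_normal_cone_def inner_diff_right)
        then have "v \<bullet> a = 0" using v(2)[of "- a"] by (simp add: orthogonal_def span_base)
        then show ?thesis using True by (simp add: ab inner_add_right inner_commute)
      next
        case False
        have "((\<lambda>s. a \<bullet> (p + s *\<^sub>R v)) \<longlongrightarrow> a \<bullet> (p + 0 *\<^sub>R v)) (at 0)" by (intro tendsto_intros)
        moreover have "a \<bullet> (p + 0 *\<^sub>R v) < b" using Ph[OF p] False by simp
        ultimately have "\<forall>\<^sub>F s in at 0. a \<bullet> (p + s *\<^sub>R v) < b" by (rule order_tendstoD)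
        then show ?thesis by (rule eventually_mono) (simp add: ab)
      qed
    qed
    then have "\<forall>\<^sub>F s in at 0. \<forall>h\<in>F. p + s *\<^sub>R v \<in> h"
      using F(1) by (intro eventually_ball_finite) auto
    then obtain d :: real where d: "d > 0" "\<And>s. s \<noteq> 0 \<Longrightarrow> \<bar>s\<bar> < d \<Longrightarrow> p + s *\<^sub>R v \<in> P"
      unfolding eventually_at F(2) by (auto simp: dist_real_def)
    let ?x = "p + (d / 2) *\<^sub>R v" and ?y = "p + (- d / 2) *\<^sub>R v"
    have "?x \<in> P" "?y \<in> P" using d(1) d(2)[of "d / 2"] d(2)[of "- d / 2"] by auto
    moreover have "p \<in> open_segment ?x ?y"
    proof -
      have "midpoint ?x ?y = p" by (simp add: midpoint_def algebra_simps flip: scaleR_2)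
      moreover have "?x \<noteq> ?y"
      proof -
        have "?x - ?y = d *\<^sub>R v" by (simp flip: scaleR_left.add)
        then have "?x - ?y \<noteq> 0" using d(1) v(1) by (metis less_irrefl scaleR_eq_0_iff)
        then show ?thesis by (metis right_minus_eq)
      qed
      ultimately show ?thesis by (metis midpoint_in_open_segment)
    qed
    ultimately show False using assms(2) unfolding extreme_point_of_def by blast
  qed
  then have "dim ?N = DIM('a)" using dim_subset_UNIV[of ?N] by linarith
  moreover have "0 \<in> affine hull ?N" by (rule hull_inc) (simp add: outward_normal_cone_def)
  ultimately show ?thesis by (simp add: aff_dim_zero)
qed

lemma outward_normal_cone_scale:
  "c \<ge> 0 \<Longrightarrow> \<eta> \<in> outward_normal_cone P p \<Longrightarrow> c *\<^sub>R \<eta> \<in> outward_normal_cone P p"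
  by (simp add: outward_normal_cone_def)

text \<open>A functional that is nonnegative on the directions has the same lower bounds on the sum as on
  the generating points, so that finitely many points decide membership when \<open>S\<close> is finite.\<close>

lemma normal_cone_hull_plus_cone_iff:
  assumes "D = {s + k | s k. s \<in> convex hull S \<and> k \<in> K}" "0 \<in> K"
    and pos: "\<And>k. k \<in> K \<Longrightarrow> 0 \<le> \<eta> \<bullet> k"
  shows "\<eta> \<in> outward_normal_cone D p \<longleftrightarrow> (\<forall>s\<in>S. \<eta> \<bullet> p \<le> \<eta> \<bullet> s)"
proof
  assume N: "\<eta> \<in> outward_normal_cone D p"
  have "s \<in> D" if "s \<in> S" for s
  proof -
    have "s + 0 \<in> D" unfolding assms(1) using hull_inc[OF that] assms(2) by blast
    then show ?thesis by simp
  qed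
  then show "\<forall>s\<in>S. \<eta> \<bullet> p \<le> \<eta> \<bullet> s"
    using N by (auto simp: outward_normal_cone_def inner_diff_right)
next
  assume "\<forall>s\<in>S. \<eta> \<bullet> p \<le> \<eta> \<bullet> s"
  then have "S \<subseteq> {x. \<eta> \<bullet> x \<ge> \<eta> \<bullet> p}" by auto
  then have "convex hull S \<subseteq> {x. \<eta> \<bullet> x \<ge> \<eta> \<bullet> p}"
    by (intro hull_minimal convex_halfspace_ge)
  then have "\<eta> \<bullet> p \<le> \<eta> \<bullet> (s + k)" if "s \<in> convex hull S" "k \<in> K" for s k
    using that pos[OF that(2)] by (auto simp: inner_add_right add_increasing2)
  then show "\<eta> \<in> outward_normal_cone D p"
    unfolding assms(1) outward_normal_cone_def by (auto simp: inner_diff_right)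
qed

lemma open_pos_orthant: "open (pos_orthant :: (real ^ 'l::finite) set)"
proof -
  have "pos_orthant = (\<Inter>l\<in>UNIV. {w :: real ^ 'l. 0 < w $ l})" by (auto simp: pos_orthant_def)
  moreover have "open {w :: real ^ 'l. 0 < w $ l}" for l
    by (intro open_Collect_less continuous_intros)
  ultimately show ?thesis by (metis finite_class.finite_UNIV open_INT)
qed

text \<open>An interior point \<open>w\<close> of the slice yields the open cone over a ball around \<open>w\<close>, which is
  the preimage of that ball under \<open>(w, t) \<mapsto> w / t\<close> on the half-space \<open>t > 0\<close>. The converse is the
  continuity of \<open>w \<mapsto> (w, 1)\<close>.\<close>

lemma interior_slice_cone_iff:
  fixes N :: "((real ^ 'l::finite) \<times> real) set"
  assumes cone: "\<And>c \<eta>. c \<ge> 0 \<Longrightarrow> \<eta> \<in> N \<Longrightarrow> c *\<^sub>R \<eta> \<in> N"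
  shows "interior {w \<in> pos_orthant. (w, 1) \<in> N} \<noteq> {} \<longleftrightarrow>
         (\<exists>w\<in>pos_orthant. (w, 1) \<in> interior N)"
proof
  let ?R = "{w \<in> pos_orthant. (w, 1) \<in> N}"
  assume "interior ?R \<noteq> {}"
  then obtain w where w: "w \<in> interior ?R" by blast
  define U where "U = {\<eta> :: (real ^ 'l) \<times> real. 0 < snd \<eta>}"
  define G where "G = (\<lambda>\<eta> :: (real ^ 'l) \<times> real. fst \<eta> /\<^sub>R snd \<eta>)"
  have "open U" unfolding U_def by (intro open_Collect_less continuous_intros)
  moreover have "continuous_on U G"
    unfolding G_def U_def by (intro continuous_intros) auto
  ultimately have "open (U \<inter> G -` interior ?R)"
    by (intro continuous_open_preimage) auto
  moreover have "U \<inter> G -` interior ?R \<subseteq> N"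
  proof
    fix \<eta> assume \<eta>: "\<eta> \<in> U \<inter> G -` interior ?R"
    then have "(G \<eta>, 1) \<in> N" using interior_subset[of ?R] by auto
    then have "snd \<eta> *\<^sub>R (G \<eta>, 1) \<in> N" using \<eta> by (intro cone) (auto simp: U_def)
    moreover have "snd \<eta> *\<^sub>R (G \<eta>, 1) = \<eta>"
      using \<eta> by (auto simp: U_def G_def prod_eq_iff)
    ultimately show "\<eta> \<in> N" by simp
  qed
  moreover have "(w, 1) \<in> U \<inter> G -` interior ?R" using w by (simp add: U_def G_def)
  ultimately have "(w, 1) \<in> interior N" by (meson interiorI)
  moreover have "w \<in> pos_orthant" using w interior_subset[of ?R] by auto
  ultimately show "\<exists>w\<in>pos_orthant. (w, 1) \<in> interior N" by blast
next
  let ?R = "{w \<in> pos_orthant. (w, 1) \<in> N}"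
  assume "\<exists>w\<in>pos_orthant. (w, 1) \<in> interior N"
  then obtain w where w: "w \<in> pos_orthant" "(w, 1) \<in> interior N" by blast
  define W where "W = pos_orthant \<inter> (\<lambda>w :: real ^ 'l. (w, 1::real)) -` interior N"
  have "open W" unfolding W_def
    by (intro open_Int open_pos_orthant open_vimage open_interior continuous_intros)
  moreover have "W \<subseteq> ?R" unfolding W_def using interior_subset[of N] by auto
  moreover have "w \<in> W" using w by (simp add: W_def)
  ultimately show "interior ?R \<noteq> {}" using interiorI by blast
qed

lemma polyhedral_region_finite_inequalities:
  fixes A :: "((real ^ 'l::finite) \<times> real) set"
  assumes "finite A" "R = {w \<in> pos_orthant. \<forall>c\<in>A. fst c \<bullet> w \<le> snd c}"
  shows "polyhedral_region R"
proof -
  obtain xs where xs: "set xs = A" using assms(1) finite_list by blast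
  have "(\<forall>c\<in>A. Q c) \<longleftrightarrow> (\<forall>k<length xs. Q (xs ! k))" for Q
    unfolding xs[symmetric] by (rule all_set_conv_all_nth)
  then have "R = {w \<in> pos_orthant. (\<forall>k<length xs. fst (xs ! k) \<bullet> w \<le> snd (xs ! k)) \<and>
               (\<forall>k<0::nat. (0 :: real ^ 'l) \<bullet> w = 0)}"
    unfolding assms(2) by simp
  then show ?thesis unfolding polyhedral_region_def
    by (intro exI[of _ "length xs"] exI[of _ 0] exI[of _ "\<lambda>k. fst (xs ! k)"]
        exI[of _ "\<lambda>k. snd (xs ! k)"] exI[of _ "\<lambda>_. 0"] exI[of _ "\<lambda>_. 0"])
qed

section \<open>The lexicographic outcome is a vertex\<close>

lemma lex_feasible_antimono: "i \<le> j \<Longrightarrow> lex_feasible Z V j \<subseteq> lex_feasible Z V i"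
  by (induction rule: dec_induct) auto

lemma lex_value_le:
  assumes "\<And>z. 0 \<le> V (Suc i) z" "z \<in> lex_feasible Z V i"
  shows "lex_value Z V (Suc i) \<le> V (Suc i) z"
  unfolding lex_value_def diff_Suc_1
  by (rule cINF_lower) (use assms in \<open>auto intro: bdd_belowI2[where m = 0]\<close>)

lemma lex_feasible_value:
  assumes "z \<in> lex_feasible Z V L" "i \<in> {1..L}"
  shows "V i z = lex_value Z V i"
proof -
  obtain k where k: "i = Suc k" using assms(2) by (cases i) auto
  then have "z \<in> lex_feasible Z V (Suc k)" using lex_feasible_antimono[of i L Z V] assms by (metis atLeastAtMost_iff subsetD)
  then show ?thesis by (simp add: k lex_value_def)
qed

lemma convex_combination_ge_imp_eq:
  fixes x y c u :: real
  assumes "0 < u" "u < 1" "c \<le> x" "c \<le> y" "(1 - u) * x + u * y \<le> c"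
  shows "x = c" "y = c"
proof -
  have "0 \<le> (1 - u) * (x - c)" "0 \<le> u * (y - c)" using assms by auto
  moreover have "(1 - u) * (x - c) + u * (y - c) \<le> 0" using assms(5) by (simp add: algebra_simps)
  ultimately have "(1 - u) * (x - c) = 0" "u * (y - c) = 0" by linarith+
  then show "x = c" "y = c" using assms by auto
qed

text \<open>Each level forces both points into the feasible set of the next one, because an average of
  two values that are at least the minimum can be at most the minimum only if both are equal to it.\<close>

lemma lex_feasible_average:
  assumes nonneg: "\<And>i z. i \<in> {1..L} \<Longrightarrow> 0 \<le> V i z"
    and z: "z1 \<in> Z" "z2 \<in> Z" and u: "0 < u" "u < 1"
    and avg: "\<And>i. i \<in> {1..L} \<Longrightarrow> (1 - u) * V i z1 + u * V i z2 \<le> lex_value Z V i"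
  shows "i \<le> L \<Longrightarrow> z1 \<in> lex_feasible Z V i \<and> z2 \<in> lex_feasible Z V i"
proof (induction i)
  case 0
  then show ?case using z by simp
next
  case (Suc i)
  then have "lex_value Z V (Suc i) \<le> V (Suc i) z1" "lex_value Z V (Suc i) \<le> V (Suc i) z2"
    using nonneg by (auto intro: lex_value_le)
  moreover have "(1 - u) * V (Suc i) z1 + u * V (Suc i) z2 \<le> lex_value Z V (Suc i)"
    using Suc.prems by (intro avg) auto
  ultimately have "V (Suc i) z1 = lex_value Z V (Suc i)" "V (Suc i) z2 = lex_value Z V (Suc i)"
    using convex_combination_ge_imp_eq u by blast+
  then show ?case using Suc by (simp add: lex_value_def)
qed

definition outcome ::
  "('l::finite \<Rightarrow> nat) \<Rightarrow> (nat \<Rightarrow> 'a \<Rightarrow> real) \<Rightarrow> ('a \<Rightarrow> real) \<Rightarrow> 'a \<Rightarrow> (real ^ 'l) \<times> real" where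
  "outcome lev V J z = (\<chi> l. V (lev l) z, J z)"

lemma le_prod_vec_Basis_iff:
  fixes p q :: "(real ^ 'l::finite) \<times> real"
  shows "(\<forall>b\<in>Basis. p \<bullet> b \<le> q \<bullet> b) \<longleftrightarrow> (\<forall>l. fst p $ l \<le> fst q $ l) \<and> snd p \<le> snd q"
  by (auto simp: Basis_prod_def Basis_vec_def inner_prod_def inner_axis)

lemma dominated_set_outcome:
  "dominated_set (outcome lev V J) Z = {(y, t). \<exists>z\<in>Z. (\<forall>l. V (lev l) z \<le> y $ l) \<and> J z \<le> t}"
proof (rule set_eqI)
  fix q show "q \<in> dominated_set (outcome lev V J) Z \<longleftrightarrow>
      q \<in> {(y, t). \<exists>z\<in>Z. (\<forall>l. V (lev l) z \<le> y $ l) \<and> J z \<le> t}"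
    unfolding dominated_set_def le_prod_vec_Basis_iff outcome_def mem_Collect_eq
    by (simp add: case_prod_beta)
qed

lemma outcome_components:
  assumes "b \<in> Basis"
  shows "(\<lambda>z. outcome lev V J z \<bullet> b) = J \<or> (\<exists>l. (\<lambda>z. outcome lev V J z \<bullet> b) = V (lev l))"
  using assms by (auto simp: Basis_prod_def Basis_vec_def inner_prod_def inner_axis outcome_def)

lemma lex_outcome_extreme:
  assumes lev: "range lev = {1..L}"
    and nonneg: "\<And>i z. i \<in> {1..L} \<Longrightarrow> 0 \<le> V i z"
    and zlex: "is_arg_min J (\<lambda>z. z \<in> lex_feasible Z V L) zlex"
  shows "(\<chi> l. lex_value Z V (lev l), J zlex) extreme_point_of dominated_set (outcome lev V J) Z"
    (is "?p extreme_point_of ?D")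
  unfolding extreme_point_of_def
proof (intro conjI ballI notI)
  have feas: "zlex \<in> lex_feasible Z V L" and
    min: "\<And>z. z \<in> lex_feasible Z V L \<Longrightarrow> J zlex \<le> J z"
    using zlex by (auto simp: is_arg_min_def not_less)
  have levl: "lev l \<in> {1..L}" for l using lev by blast
  have "zlex \<in> Z" using lex_feasible_antimono[of 0 L Z V] feas by auto
  then show "?p \<in> ?D"
    unfolding dominated_set_outcome using lex_feasible_value[OF feas levl] by (auto intro!: bexI[of _ zlex])
  fix a b assume a: "a \<in> ?D" and b: "b \<in> ?D" and "?p \<in> open_segment a b"
  then obtain u where ne: "a \<noteq> b" and u: "0 < u" "u < 1" and p: "?p = (1 - u) *\<^sub>R a + u *\<^sub>R b"
    by (auto simp: in_segment)
  obtain z1 where z1: "z1 \<in> Z" "\<And>l. V (lev l) z1 \<le> fst a $ l" "J z1 \<le> snd a"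
    using a unfolding dominated_set_outcome by auto
  obtain z2 where z2: "z2 \<in> Z" "\<And>l. V (lev l) z2 \<le> fst b $ l" "J z2 \<le> snd b"
    using b unfolding dominated_set_outcome by auto
  have py: "lex_value Z V (lev l) = (1 - u) * fst a $ l + u * fst b $ l" for l
    using arg_cong[OF p, of "\<lambda>q. fst q $ l"] by simp
  have pt: "J zlex = (1 - u) * snd a + u * snd b"
    using arg_cong[OF p, of snd] by simp
  have "(1 - u) * V i z1 + u * V i z2 \<le> lex_value Z V i" if iL: "i \<in> {1..L}" for i
  proof -
    obtain l where i: "i = lev l" using lev iL by blast
    show ?thesis unfolding i py using z1(2) z2(2) u by (intro add_mono mult_left_mono) auto
  qed
  then have z12: "z1 \<in> lex_feasible Z V L" "z2 \<in> lex_feasible Z V L"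
    using lex_feasible_average[OF nonneg z1(1) z2(1) u, of L] by auto
  have "fst a $ l = lex_value Z V (lev l)" "fst b $ l = lex_value Z V (lev l)" for l
    using convex_combination_ge_imp_eq[OF u, of _ "fst a $ l" "fst b $ l"] py[of l] z1(2)[of l] z2(2)[of l]
      lex_feasible_value[OF z12(1) levl] lex_feasible_value[OF z12(2) levl] by auto
  moreover have "snd a = J zlex" "snd b = J zlex"
    using convex_combination_ge_imp_eq[OF u, of "J zlex" "snd a" "snd b"] pt z1(3) z2(3)
      min[OF z12(1)] min[OF z12(2)] by auto
  ultimately have "a = b" by (simp add: prod_eq_iff vec_eq_iff)
  then show False using ne by simp
qed

section \<open>Geometry of the upper image and the equivalence region\<close>

theorem mainTheorem2:
  fixes L :: nat and m :: "nat \<Rightarrow> nat"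
    and lev :: "'l::finite \<Rightarrow> nat"
    and Z :: "(real ^ 'd::finite) set"
    and J :: "real ^ 'd \<Rightarrow> real"
    and g :: "nat \<Rightarrow> nat \<Rightarrow> real ^ 'd \<Rightarrow> real"
    and V :: "nat \<Rightarrow> real ^ 'd \<Rightarrow> real"
    and zlex :: "real ^ 'd"
    and pstar :: "(real ^ 'l) \<times> real"
    and P :: "((real ^ 'l) \<times> real) set"
  assumes "bij_betw lev UNIV {1..L}"
    and "\<forall>i\<in>{1..L}. m i \<ge> 1"
    and "polyhedron Z"
    and "\<forall>i\<in>{1..L}. \<forall>j\<in>{1..m i}. affine_fun (g i j)"
    and "convex_on UNIV J"
    and "piecewise_affine J"
    and "\<forall>i\<in>{1..L}. V i = hinge_sum (m i) (g i)"
    and "compact Z"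
    and "\<forall>i\<in>{1..L}. \<exists>z. is_arg_min (V i) (\<lambda>z. z \<in> lex_feasible Z V (i - 1)) z"
    and "\<exists>z. is_arg_min J (\<lambda>z. z \<in> lex_feasible Z V L) z"
    and "\<forall>w\<in>pos_orthant. \<exists>z. is_arg_min (weighted_sum lev V J w) (\<lambda>z. z \<in> Z) z"
    and "is_arg_min J (\<lambda>z. z \<in> lex_feasible Z V L) zlex"
    and "\<forall>z. is_arg_min J (\<lambda>z. z \<in> lex_feasible Z V L) z \<longrightarrow> z = zlex"
    and "pstar = (\<chi> l. lex_value Z V (lev l), J zlex)"
    and "P = upper_image lev Z V J"
  shows "(polyhedron P \<and> aff_dim P = int (L + 1))
    \<and> (pstar extreme_point_of P \<and> aff_dim (outward_normal_cone P pstar) = int (L + 1))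
    \<and> polyhedral_region (equivalence_region P pstar)
    \<and> (equivalence_region P pstar \<noteq> {} \<longleftrightarrow>
          {(w, 1) | w. w \<in> pos_orthant} \<inter> outward_normal_cone P pstar \<noteq> {})
    \<and> (interior (equivalence_region P pstar) \<noteq> {} \<longleftrightarrow>
          {(w, 1) | w. w \<in> UNIV} \<inter> interior (outward_normal_cone P pstar)
            \<inter> (pos_orthant \<times> {1}) \<noteq> {})"
proof -
  note lev = assms(1) and polyZ = assms(3) and aff = assms(4) and Jconv = assms(5)
    and Jpw = assms(6) and V = assms(7) and cpt = assms(8) and zlex = assms(12)
    and pstar = assms(14) and P = assms(15)
  let ?F = "outcome lev V J"
  let ?D = "dominated_set ?F Z"
  let ?N = "outward_normal_cone P pstar"
  have range: "range lev = {1..L}" using lev by (simp add: bij_betw_def)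
  then have levl: "lev l \<in> {1..L}" for l by blast
  have DIM: "DIM((real ^ 'l) \<times> real) = L + 1" using bij_betw_same_card[OF lev] by simp
  have Vpw: "piecewise_affine (V i)" and Vconv: "convex_on UNIV (V i)"
    and nonneg: "0 \<le> V i z" if "i \<in> {1..L}" for i z
    using that V aff
    by (auto intro: piecewise_affine_hinge_sum convex_on_hinge_sum) (auto simp: hinge_sum_def intro: sum_nonneg)
  have polytope: "polytope Z"
    using polyZ cpt by (simp add: polytope_eq_bounded_polyhedron compact_imp_bounded)
  obtain S where S: "finite S"
    "?D = {s + k | s k. s \<in> convex hull S \<and> k \<in> convex_cone hull Basis}"
  proof (rule dominated_set_eq_hull_plus_orthant[OF polytope, of ?F])
    fix b :: "(real ^ 'l) \<times> real" assume b: "b \<in> Basis"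
    show "piecewise_affine (\<lambda>z. ?F z \<bullet> b)"
      using outcome_components[OF b, of lev V J] Jpw Vpw levl by metis
    have "convex_on UNIV (\<lambda>z. ?F z \<bullet> b)"
      using outcome_components[OF b, of lev V J] Jconv Vconv levl by metis
    then show "convex_on Z (\<lambda>z. ?F z \<bullet> b)"
      by (rule convex_on_subset) (simp_all add: polytope_imp_convex[OF polytope])
  qed blast
  have polyD: "polyhedron ?D"
    unfolding S(2) by (intro polyhedron_convex_hull_plus_cone S(1) finite_Basis)
  have PD: "P = ?D"
    unfolding P upper_image_def dominated_set_outcome[symmetric]
    by (rule closure_closed[OF polyhedron_imp_closed[OF polyD]])
  have "zlex \<in> Z"
    using zlex lex_feasible_antimono[of 0 L Z V] by (auto simp: is_arg_min_def)
  have dimP: "aff_dim P = int (L + 1)"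
    unfolding PD aff_dim_dominated_set[OF \<open>zlex \<in> Z\<close>] DIM by (rule refl)
  have ext: "pstar extreme_point_of P"
    unfolding PD pstar by (rule lex_outcome_extreme[OF range nonneg zlex])
  have dimN: "aff_dim ?N = int (L + 1)"
    using aff_dim_outward_normal_cone_extreme_point[OF _ ext] polyD unfolding PD DIM by blast
  have region: "equivalence_region P pstar = {w \<in> pos_orthant. (w, 1) \<in> ?N}"
    by (simp add: equivalence_region_def)

  have "(w, 1) \<in> ?N \<longleftrightarrow> (\<forall>s\<in>S. (w, 1) \<bullet> pstar \<le> (w, 1) \<bullet> s)" if w: "w \<in> pos_orthant" for w
    unfolding PD
  proof (rule normal_cone_hull_plus_cone_iff[OF S(2) convex_cone_hull_contains_0])
    fix k :: "(real ^ 'l) \<times> real" assume "k \<in> convex_cone hull Basis"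
    then have "\<forall>b\<in>Basis. 0 \<bullet> b \<le> k \<bullet> b" by (simp add: convex_cone_hull_Basis)
    then have k: "\<And>l. 0 \<le> fst k $ l" "0 \<le> snd k" unfolding le_prod_vec_Basis_iff by auto
    have "0 \<le> w \<bullet> fst k" unfolding inner_vec_def
      using w k(1) by (intro sum_nonneg) (auto simp: pos_orthant_def less_imp_le)
    then show "0 \<le> (w, 1) \<bullet> k" using k(2) by (simp add: inner_prod_def)
  qed
  then have "equivalence_region P pstar = {w \<in> pos_orthant.
      \<forall>c\<in>(\<lambda>s. (fst pstar - fst s, snd s - snd pstar)) ` S. fst c \<bullet> w \<le> snd c}"
    unfolding region by (auto simp: inner_prod_def inner_diff_left inner_commute algebra_simps)
  then have polyR: "polyhedral_region (equivalence_region P pstar)"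
    by (rule polyhedral_region_finite_inequalities[rotated]) (simp add: S(1))

  have nonempty: "equivalence_region P pstar \<noteq> {} \<longleftrightarrow>
      {(w, 1) | w. w \<in> pos_orthant} \<inter> ?N \<noteq> {}"
    unfolding region by auto
  have "interior (equivalence_region P pstar) \<noteq> {} \<longleftrightarrow> (\<exists>w\<in>pos_orthant. (w, 1) \<in> interior ?N)"
    unfolding region by (rule interior_slice_cone_iff) (rule outward_normal_cone_scale)
  also have "\<dots> \<longleftrightarrow> {(w, 1) | w. w \<in> UNIV} \<inter> interior ?N \<inter> (pos_orthant \<times> {1}) \<noteq> {}"
    by auto
  finally show ?thesis using polyD dimP ext dimN polyR nonempty unfolding PD by blast
qed

end
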